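(* Let $V_T^\star$ and $V_H$ be disjoint finite sets (transformer nodes and residence nodes, respectively), let $V^\star = V_T^\star \cup V_H$, and let $G^\star = (V^\star, E^\star)$ be a finite simple undirected graph with no edge joining two nodes of $V_T^\star$. Assume that the transformer nodes are root nodes of distinct components, i.e. no two distinct nodes of $V_T^\star$ lie in the same connected component of $G^\star$ (so $G^\star$ has at least $|V_T^\star|$ connected components). Let $\mathbf{A_H} \in \mathbb{R}^{|E^\star| \times |V_H|}$ be the reduced branch-bus incidence matrix of $G^\star$ consisting of the columns corresponding to $V_H$, and let $\mathbf{p} \in \mathbb{R}^{|V_H|}$ be a vector all of whose entries are strictly positive. Then $G^\star$ has exactly $|V_T^\star|$ connected components if and only if there exists $\mathbf{f} \in \mathbb{R}^{|E^\star|}$ such that $$\mathbf{A_H}^T \mathbf{f} = \mathbf{p}.$$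
   Context: Each edge $e = (i,j) \in E^\star$ is given an arbitrary fixed orientation from $i$ to $j$. The branch-bus incidence matrix of $G^\star$ is the $|E^\star| \times |V^\star|$ matrix $\mathbf{A}$ with entries, for $e = (i,j)$ and a node $k$: $\mathbf{A}(e,k) = 1$ if $k = i$, $\mathbf{A}(e,k) = -1$ if $k = j$, and $\mathbf{A}(e,k) = 0$ otherwise. The reduced branch-bus incidence matrix $\mathbf{A_H}$ is the submatrix of $\mathbf{A}$ formed by the columns indexed by $V_H$ (rows indexed by all edges of $E^\star$). The vector $\mathbf{p}$ represents power demands at residence nodes and $\mathbf{f}$ represents (signed, unconstrained) flows on edges; $\mathbf{A_H}^T\mathbf{f} = \mathbf{p}$ is the power balance equation at the residence nodes. *)

theory Defs
  imports Complex_Main "HOL-Library.FuncSet"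
begin

text \<open>An undirected edge is the two-element set of its end points, so loops and
  parallel edges are excluded.\<close>

definition finite_simple_graph :: "'v set \<Rightarrow> 'v set set \<Rightarrow> bool" where
  "finite_simple_graph V E \<longleftrightarrow> finite V \<and> (\<forall>e\<in>E. e \<subseteq> V \<and> card e = 2)"

definition adjacency :: "'v set set \<Rightarrow> ('v \<times> 'v) set" where
  "adjacency E = {(u, v). {u, v} \<in> E}"

definition connected_components :: "'v set \<Rightarrow> 'v set set \<Rightarrow> 'v set set" where
  "connected_components V E = V // {(u, v) \<in> V \<times> V. (u, v) \<in> (adjacency E)\<^sup>*}"

text \<open>An orientation sends an edge to the pair (start node, end node).\<close>

definition orientation :: "'v set set \<Rightarrow> ('v set \<Rightarrow> 'v \<times> 'v) \<Rightarrow> bool" where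
  "orientation E ori \<longleftrightarrow> (\<forall>e\<in>E. e = {fst (ori e), snd (ori e)})"

text \<open>Matrices and vectors are indexed by finite sets, which may be empty: \<open>\<real>\<^sup>S\<close> is
  \<open>S \<rightarrow>\<^sub>E UNIV\<close>, and a matrix with rows in \<open>I\<close> and columns in \<open>J\<close> is an
  element of \<open>I \<rightarrow>\<^sub>E J \<rightarrow>\<^sub>E UNIV\<close>. Values outside the index sets are
  \<open>undefined\<close>, so that equality of vectors is equality of their entries.\<close>

definition incidence_matrix ::
    "'v set \<Rightarrow> 'v set set \<Rightarrow> ('v set \<Rightarrow> 'v \<times> 'v) \<Rightarrow> 'v set \<Rightarrow> 'v \<Rightarrow> real" where
  "incidence_matrix V E ori =
     (\<lambda>e\<in>E. \<lambda>k\<in>V. if k = fst (ori e) then 1 else if k = snd (ori e) then - 1 else 0)"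

definition column_submatrix :: "'i set \<Rightarrow> 'j set \<Rightarrow> ('i \<Rightarrow> 'j \<Rightarrow> real) \<Rightarrow> 'i \<Rightarrow> 'j \<Rightarrow> real" where
  "column_submatrix I J M = (\<lambda>i\<in>I. \<lambda>j\<in>J. M i j)"

definition reduced_incidence_matrix ::
    "'v set \<Rightarrow> 'v set \<Rightarrow> 'v set set \<Rightarrow> ('v set \<Rightarrow> 'v \<times> 'v) \<Rightarrow> 'v set \<Rightarrow> 'v \<Rightarrow> real" where
  "reduced_incidence_matrix V\<^sub>T V\<^sub>H E ori =
     column_submatrix E V\<^sub>H (incidence_matrix (V\<^sub>T \<union> V\<^sub>H) E ori)"

definition mat_transpose :: "'i set \<Rightarrow> 'j set \<Rightarrow> ('i \<Rightarrow> 'j \<Rightarrow> real) \<Rightarrow> 'j \<Rightarrow> 'i \<Rightarrow> real" where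
  "mat_transpose I J M = (\<lambda>j\<in>J. \<lambda>i\<in>I. M i j)"

definition mat_vec_mult :: "'i set \<Rightarrow> 'j set \<Rightarrow> ('i \<Rightarrow> 'j \<Rightarrow> real) \<Rightarrow> ('j \<Rightarrow> real) \<Rightarrow> 'i \<Rightarrow> real" where
  "mat_vec_mult I J M x = (\<lambda>i\<in>I. \<Sum>j\<in>J. M i j * x j)"

end

(*
  Summing the balance equation over a connected component without a root cancels every edge and
  leaves a positive total demand equal to 0; hence solvability forces a root into every component.
  Conversely, if every residence node is joined to a root, sending its demand along a path to that
  root balances it, and the flows for the individual nodes superpose.
*)
theory Submission imports Defs begin

text \<open>Sending a point of \<open>T\<close> to its class is injective, since distinct points of
  \<open>T\<close> are unrelated. As there are finitely many classes, the two cardinalities agree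
  exactly when this map hits every class, and the classes it hits are those that meet
  \<open>T\<close>. Applied to connectivity, this turns the count of components into the statement
  that every component contains a root.\<close>

lemma card_quotient_eq_card_iff:
  assumes "equiv V r" and "finite V" and "T \<subseteq> V"
    and unrelated: "\<And>s t. s \<in> T \<Longrightarrow> t \<in> T \<Longrightarrow> s \<noteq> t \<Longrightarrow> (s, t) \<notin> r"
  shows "card (V // r) = card T \<longleftrightarrow> (\<forall>C\<in>V // r. C \<inter> T \<noteq> {})"
proof -
  let ?c = "\<lambda>t. r `` {t}"
  have fin: "finite (V // r)"
    using assms by (simp add: quotient_def)
  have inj: "inj_on ?c T"
  proof (rule inj_onI)
    fix s t assume "s \<in> T" "t \<in> T" "?c s = ?c t"
    then have "(s, t) \<in> r"
      using eq_equiv_class[OF _ \<open>equiv V r\<close>] \<open>T \<subseteq> V\<close> by blast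
    with \<open>s \<in> T\<close> \<open>t \<in> T\<close> unrelated show "s = t" by blast
  qed
  have sub: "?c ` T \<subseteq> V // r"
    using \<open>T \<subseteq> V\<close> by (auto intro: quotientI)
  have "card (V // r) = card T \<longleftrightarrow> ?c ` T = V // r"
    using card_image[OF inj] card_subset_eq[OF fin sub] by metis
  also have "\<dots> \<longleftrightarrow> (\<forall>C\<in>V // r. C \<in> ?c ` T)"
    using sub by blast
  also have "\<dots> \<longleftrightarrow> (\<forall>C\<in>V // r. C \<inter> T \<noteq> {})"
  proof (rule ball_cong[OF refl])
    fix C assume C: "C \<in> V // r"
    show "C \<in> ?c ` T \<longleftrightarrow> C \<inter> T \<noteq> {}"
    proof
      assume "C \<in> ?c ` T"
      then show "C \<inter> T \<noteq> {}"
        using \<open>T \<subseteq> V\<close> equiv_class_self[OF \<open>equiv V r\<close>] by blast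
    next
      assume "C \<inter> T \<noteq> {}"
      then obtain t where "t \<in> C" "t \<in> T" by blast
      moreover from this have "t \<in> ?c t"
        using \<open>T \<subseteq> V\<close> equiv_class_self[OF \<open>equiv V r\<close>] by blast
      ultimately have "C = ?c t"
        using quotient_disj[OF \<open>equiv V r\<close> C] \<open>T \<subseteq> V\<close> by (blast intro: quotientI)
      with \<open>t \<in> T\<close> show "C \<in> ?c ` T" by blast
    qed
  qed
  finally show ?thesis .
qed

lemma equiv_connectivity: "equiv V {(u, v) \<in> V \<times> V. (u, v) \<in> (adjacency E)\<^sup>*}"
proof -
  have "sym ((adjacency E)\<^sup>*)"
    by (rule sym_rtrancl) (auto simp: sym_def adjacency_def insert_commute)
  then show ?thesis
    by (intro equivI) (auto simp: refl_on_def sym_def trans_def)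
qed

text \<open>The two ends of an edge are adjacent, and a class is closed under its equivalence
  relation, so it contains both ends or neither. This is the closure condition under which edge
  contributions cancel in \<open>sum_net_outflow_eq_0\<close>.\<close>

lemma edge_subset_or_disjoint_component:
  assumes "finite_simple_graph V E" and C: "C \<in> connected_components V E" and "e \<in> E"
  shows "e \<subseteq> C \<or> e \<inter> C = {}"
proof -
  obtain u v where e: "e = {u, v}"
    using assms by (metis card_2_iff finite_simple_graph_def)
  have "u \<in> V" "v \<in> V" and "(u, v) \<in> (adjacency E)\<^sup>*"
    using assms e by (auto simp: finite_simple_graph_def adjacency_def)
  then have "u \<in> C \<longleftrightarrow> v \<in> C"
    using in_quotient_imp_closed[OF equiv_connectivity C[unfolded connected_components_def]]
      equivE[OF equiv_connectivity[of V E]]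
    by (smt (verit) case_prodI mem_Collect_eq mem_Sigma_iff symD)
  with e show ?thesis by auto
qed

text \<open>Left unrestricted in \<open>k\<close>, so that roots have a net outflow too; a path flow
  ending at a root can then be described at all nodes at once.\<close>

definition net_outflow ::
    "'v set set \<Rightarrow> ('v set \<Rightarrow> 'v \<times> 'v) \<Rightarrow> ('v set \<Rightarrow> real) \<Rightarrow> 'v \<Rightarrow> real" where
  "net_outflow E ori f k =
     (\<Sum>e\<in>E. (if k = fst (ori e) then 1 else if k = snd (ori e) then - 1 else 0) * f e)"

lemma net_outflow_add:
  "net_outflow E ori (\<lambda>e. f e + g e) k = net_outflow E ori f k + net_outflow E ori g k"
  by (simp add: net_outflow_def distrib_left sum.distrib)

lemma net_outflow_sum_scale:
  "net_outflow E ori (\<lambda>e. \<Sum>h\<in>H. c h * g h e) k = (\<Sum>h\<in>H. c h * net_outflow E ori (g h) k)"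
  unfolding net_outflow_def sum_distrib_left
  by (subst sum.swap) (simp add: mult.left_commute)

lemma net_outflow_restrict: "net_outflow E ori (restrict f E) = net_outflow E ori f"
  by (simp add: net_outflow_def fun_eq_iff)

text \<open>Removes the matrices and their index sets: solvability becomes a prescription of
  \<open>net_outflow\<close> at the residence nodes alone.\<close>

lemma mat_vec_mult_reduced_incidence:
  "mat_vec_mult V\<^sub>H E (mat_transpose E V\<^sub>H (reduced_incidence_matrix V\<^sub>T V\<^sub>H E ori)) f =
     (\<lambda>k\<in>V\<^sub>H. net_outflow E ori f k)"
  by (auto simp: mat_vec_mult_def mat_transpose_def reduced_incidence_matrix_def
      column_submatrix_def incidence_matrix_def net_outflow_def intro!: restrict_ext sum.cong)

lemma orientation_ends:
  assumes "orientation E ori" and "e \<in> E" and "e = {u, v}" and "u \<noteq> v"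
  obtains "ori e = (u, v)" | "ori e = (v, u)"
  using assms unfolding orientation_def by (metis doubleton_eq_iff prod.collapse)

text \<open>After exchanging the two sums, an edge inside \<open>C\<close> contributes its flow once
  with each sign, and an edge disjoint from \<open>C\<close> contributes nothing.\<close>

lemma sum_net_outflow_eq_0:
  assumes "finite C" and "orientation E ori" and "\<And>e. e \<in> E \<Longrightarrow> card e = 2"
    and closed: "\<And>e. e \<in> E \<Longrightarrow> e \<subseteq> C \<or> e \<inter> C = {}"
  shows "(\<Sum>k\<in>C. net_outflow E ori f k) = 0"
proof -
  have "(\<Sum>k\<in>C. net_outflow E ori f k) =
    (\<Sum>e\<in>E. (\<Sum>k\<in>C. (if k = fst (ori e) then 1 else if k = snd (ori e) then - 1 else 0)) * f e)"
    unfolding net_outflow_def by (subst sum.swap) (simp add: sum_distrib_right)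
  also have "\<dots> = 0"
  proof (rule sum.neutral, rule ballI)
    fix e assume "e \<in> E"
    let ?i = "fst (ori e)" and ?j = "snd (ori e)"
    have e: "e = {?i, ?j}"
      using assms(2) \<open>e \<in> E\<close> by (simp add: orientation_def)
    then have "?i \<noteq> ?j"
      using assms(3)[OF \<open>e \<in> E\<close>] by (metis card_2_iff doubleton_eq_iff)
    \<comment> \<open>The split into a difference of indicators relies on distinct ends: for a loop
      the nested conditional would give 1 where the difference gives 0.\<close>
    then have "(\<Sum>k\<in>C. (if k = ?i then 1 else if k = ?j then - 1 else 0 :: real)) =
      (\<Sum>k\<in>C. (if k = ?i then 1 else 0) - (if k = ?j then 1 else 0))"
      by (intro sum.cong) auto
    \<comment> \<open>Each indicator sums to 1 or 0 according to whether its end lies in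
      \<open>C\<close>, and by \<open>closed\<close> both ends lie on the same side.\<close>
    also have "\<dots> = 0"
      using closed[OF \<open>e \<in> E\<close>] \<open>finite C\<close> by (subst (asm) (1 2) e) (auto simp: sum_subtractf)
    finally show "(\<Sum>k\<in>C. (if k = ?i then 1 else if k = ?j then - 1 else 0)) * f e = 0"
      by simp
  qed
  finally show ?thesis .
qed

lemma net_outflow_single_edge:
  assumes "finite E" and "orientation E ori" and "{u, v} \<in> E" and "u \<noteq> v"
  shows "\<exists>g. \<forall>k. net_outflow E ori g k = of_bool (k = u) - of_bool (k = v)"
proof -
  \<comment> \<open>The sign corrects for the fixed orientation: one unit sent from \<open>u\<close>
    to \<open>v\<close> is a flow of -1 if the edge is oriented from \<open>v\<close> to
    \<open>u\<close>.\<close>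
  define c :: real where "c = (if fst (ori {u, v}) = u then 1 else - 1)"
  have "net_outflow E ori (\<lambda>e. if e = {u, v} then c else 0) k = of_bool (k = u) - of_bool (k = v)"
    for k
  proof -
    have "net_outflow E ori (\<lambda>e. if e = {u, v} then c else 0) k =
      (\<Sum>e\<in>E. if e = {u, v} then (if k = fst (ori e) then 1 else if k = snd (ori e) then - 1 else 0) * c
        else 0)"
      unfolding net_outflow_def by (rule sum.cong) auto
    also have "\<dots> = (if k = fst (ori {u, v}) then 1 else if k = snd (ori {u, v}) then - 1 else 0) * c"
      using assms by simp
    also have "\<dots> = of_bool (k = u) - of_bool (k = v)"
      using orientation_ends[OF assms(2,3) refl assms(4)] assms(4) by cases (auto simp: c_def)
    finally show ?thesis .
  qed
  then show ?thesis by blast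
qed

text \<open>Adding unit flows along successive edges telescopes: the -1 at the old end
  \<open>v\<close> cancels against the +1 of the next edge. Edges may be repeated, since flows are
  signed and simply add up.\<close>

lemma net_outflow_path:
  assumes "finite E" and "orientation E ori" and "\<And>e. e \<in> E \<Longrightarrow> card e = 2"
    and "(u, v) \<in> (adjacency E)\<^sup>*"
  shows "\<exists>g. \<forall>k. net_outflow E ori g k = of_bool (k = u) - of_bool (k = v)"
  using assms(4)
proof (induction rule: rtrancl_induct)
  case base
  show ?case by (rule exI[of _ "\<lambda>_. 0"]) (simp add: net_outflow_def)
next
  case (step v w)
  from step.hyps(2) have "{v, w} \<in> E" by (simp add: adjacency_def)
  moreover from assms(3)[OF this] have "v \<noteq> w" by auto
  ultimately obtain h where "\<forall>k. net_outflow E ori h k = of_bool (k = v) - of_bool (k = w)"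
    using net_outflow_single_edge[OF assms(1,2)] by blast
  moreover from step.IH obtain g
    where "\<forall>k. net_outflow E ori g k = of_bool (k = u) - of_bool (k = v)" by blast
  ultimately show ?case
    by (intro exI[of _ "\<lambda>e. g e + h e"]) (simp add: net_outflow_add)
qed

theorem mainTheorem1:
  fixes V\<^sub>T V\<^sub>H :: "'v set"
    and E :: "'v set set"
    and ori :: "'v set \<Rightarrow> 'v \<times> 'v"
    and p :: "'v \<Rightarrow> real"
  assumes "finite V\<^sub>T" and "finite V\<^sub>H"
    and "V\<^sub>T \<inter> V\<^sub>H = {}"
    and "finite_simple_graph (V\<^sub>T \<union> V\<^sub>H) E"
    and "\<forall>s\<in>V\<^sub>T. \<forall>t\<in>V\<^sub>T. {s, t} \<notin> E"
    and "\<forall>s\<in>V\<^sub>T. \<forall>t\<in>V\<^sub>T. s \<noteq> t \<longrightarrow>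
           \<not> (\<exists>C\<in>connected_components (V\<^sub>T \<union> V\<^sub>H) E. s \<in> C \<and> t \<in> C)"
    and "orientation E ori"
    and "p \<in> V\<^sub>H \<rightarrow>\<^sub>E UNIV" and "\<forall>k\<in>V\<^sub>H. p k > 0"
  shows "card (connected_components (V\<^sub>T \<union> V\<^sub>H) E) = card V\<^sub>T \<longleftrightarrow>
    (\<exists>f \<in> E \<rightarrow>\<^sub>E (UNIV :: real set).
       mat_vec_mult V\<^sub>H E (mat_transpose E V\<^sub>H (reduced_incidence_matrix V\<^sub>T V\<^sub>H E ori)) f = p)"
proof -
  let ?V = "V\<^sub>T \<union> V\<^sub>H"
  let ?r = "{(u, v) \<in> ?V \<times> ?V. (u, v) \<in> (adjacency E)\<^sup>*}"
  note graph = \<open>finite_simple_graph ?V E\<close>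
  have "finite ?V" and card2: "\<And>e. e \<in> E \<Longrightarrow> card e = 2"
    using graph by (auto simp: finite_simple_graph_def)
  have "E \<subseteq> Pow ?V"
    using graph by (auto simp: finite_simple_graph_def)
  then have "finite E"
    using \<open>finite ?V\<close> by (meson finite_Pow_iff finite_subset)
  have eqv: "equiv ?V ?r"
    by (rule equiv_connectivity)
  have component: "?r `` {v} \<in> connected_components ?V E" if "v \<in> ?V" for v
    unfolding connected_components_def using that by (rule quotientI)
  have unrelated: "(s, t) \<notin> ?r" if "s \<in> V\<^sub>T" "t \<in> V\<^sub>T" "s \<noteq> t" for s t
  proof
    assume "(s, t) \<in> ?r"
    then have "s \<in> ?r `` {s} \<and> t \<in> ?r `` {s}" by simp
    then have "\<exists>C\<in>connected_components ?V E. s \<in> C \<and> t \<in> C"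
      using component[OF UnI1[OF \<open>s \<in> V\<^sub>T\<close>]] by (rule bexI)
    moreover have "\<not> (\<exists>C\<in>connected_components ?V E. s \<in> C \<and> t \<in> C)"
      by (rule assms(6)[rule_format, OF that])
    ultimately show False by contradiction
  qed
  have rooted: "card (connected_components ?V E) = card V\<^sub>T \<longleftrightarrow>
      (\<forall>C\<in>connected_components ?V E. C \<inter> V\<^sub>T \<noteq> {})"
    unfolding connected_components_def
    by (rule card_quotient_eq_card_iff[OF eqv \<open>finite ?V\<close> _ unrelated]) auto
  show ?thesis
    unfolding rooted mat_vec_mult_reduced_incidence
  proof
    assume roots: "\<forall>C\<in>connected_components ?V E. C \<inter> V\<^sub>T \<noteq> {}"
    have "\<exists>g. \<forall>k\<in>V\<^sub>H. net_outflow E ori g k = of_bool (k = h)" if "h \<in> V\<^sub>H" for h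
    proof -
      have "?r `` {h} \<inter> V\<^sub>T \<noteq> {}"
        using roots component that by simp
      then obtain t where "t \<in> V\<^sub>T" "(h, t) \<in> (adjacency E)\<^sup>*" by blast
      then obtain g where "\<forall>k. net_outflow E ori g k = of_bool (k = h) - of_bool (k = t)"
        using net_outflow_path[OF \<open>finite E\<close> assms(7) card2] by blast
      \<comment> \<open>The compensating -1 sits at the root \<open>t\<close>, which lies outside
        \<open>V\<^sub>H\<close> by disjointness and hence is invisible to the balance
        equation.\<close>
      with \<open>t \<in> V\<^sub>T\<close> show ?thesis
        using assms(3) by (intro exI[of _ g]) auto
    qed
    then obtain g where g: "\<And>h k. h \<in> V\<^sub>H \<Longrightarrow> k \<in> V\<^sub>H \<Longrightarrow> net_outflow E ori (g h) k = of_bool (k = h)"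
      by metis
    \<comment> \<open>Superposition: each \<open>g h\<close> serves one unit of demand at
      \<open>h\<close> and none at the other residence nodes, so it is weighted by
      \<open>p h\<close>.\<close>
    let ?f = "\<lambda>e. \<Sum>h\<in>V\<^sub>H. p h * g h e"
    have "net_outflow E ori ?f k = p k" if "k \<in> V\<^sub>H" for k
    proof -
      have "net_outflow E ori ?f k = (\<Sum>h\<in>V\<^sub>H. if k = h then p h else 0)"
        unfolding net_outflow_sum_scale using that by (intro sum.cong) (auto simp: g)
      with that assms(2) show ?thesis by simp
    qed
    \<comment> \<open>Restricting to \<open>E\<close> makes the flow a legitimate vector without
      changing any net outflow. Equality with \<open>p\<close> also holds outside
      \<open>V\<^sub>H\<close>, where both sides are \<open>undefined\<close>.\<close>
    then have "(\<lambda>k\<in>V\<^sub>H. net_outflow E ori (restrict ?f E) k) = p"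
      unfolding net_outflow_restrict
      using assms(8) by (auto simp: fun_eq_iff restrict_def PiE_def extensional_def)
    then show "\<exists>f\<in>E \<rightarrow>\<^sub>E UNIV. (\<lambda>k\<in>V\<^sub>H. net_outflow E ori f k) = p"
      by (intro bexI[of _ "restrict ?f E"]) auto
  next
    assume "\<exists>f\<in>E \<rightarrow>\<^sub>E UNIV. (\<lambda>k\<in>V\<^sub>H. net_outflow E ori f k) = p"
    then obtain f where f: "\<And>k. k \<in> V\<^sub>H \<Longrightarrow> net_outflow E ori f k = p k"
      by (metis restrict_apply')
    show "\<forall>C\<in>connected_components ?V E. C \<inter> V\<^sub>T \<noteq> {}"
    proof (intro ballI notI)
      fix C assume C: "C \<in> connected_components ?V E" and "C \<inter> V\<^sub>T = {}"
      have "C \<subseteq> ?V" "C \<noteq> {}"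
        using C in_quotient_imp_subset[OF eqv] in_quotient_imp_non_empty[OF eqv]
        unfolding connected_components_def by auto
      \<comment> \<open>A component without a root has only residence nodes, so the balance equation
        is available at each of its nodes.\<close>
      with \<open>C \<inter> V\<^sub>T = {}\<close> have "C \<subseteq> V\<^sub>H" by blast
      then have "finite C" using assms(2) by (rule finite_subset)
      \<comment> \<open>Strictness comes from \<open>C\<close> being nonempty, as every equivalence
        class is.\<close>
      have "0 < (\<Sum>k\<in>C. p k)"
        using \<open>finite C\<close> \<open>C \<noteq> {}\<close> \<open>C \<subseteq> V\<^sub>H\<close> assms(9) by (intro sum_pos) auto
      also have "\<dots> = (\<Sum>k\<in>C. net_outflow E ori f k)"
        using \<open>C \<subseteq> V\<^sub>H\<close> f by (intro sum.cong) auto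
      also have "\<dots> = 0"
        using \<open>finite C\<close> assms(7) card2 edge_subset_or_disjoint_component[OF graph C]
        by (rule sum_net_outflow_eq_0)
      finally show False by simp
    qed
  qed
qed

end
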